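(* Let $M$ be a nonnegative real $N\times N$ matrix defining a strongly connected graph, with dominant positive eigenvalue $\lambda$ and positive right eigenvector $\psi$, $M\psi=\lambda\psi$. Among all stochastic matrices $S$ on $M$, the Maximal Entropy Random Walk $$S^{\mathrm{M}}_{ij}=\frac{M_{ij}}{\lambda}\frac{\psi_j}{\psi_i}$$ is the only one for which, for any length $l\ge 1$ and any two vertices $a,b$, any two length $l$ pathways $(\gamma_0,\dots,\gamma_l)$ and $(\gamma'_0,\dots,\gamma'_l)$ on $M$ with $\gamma_0=\gamma'_0=a$ and $\gamma_l=\gamma'_l=b$ are equally probable; that is, $S=S^{\mathrm{M}}$ has this property and any $S$ with this property equals $S^{\mathrm{M}}$.
   Context: A (weighted, possibly directed) graph on vertices $\{1,\dots,N\}$ is identified with a nonnegative real $N\times N$ matrix $M$; there is an edge from $i$ to $j$ iff $M_{ij}>0$ (self-loops allowed). The graph is strongly connected if for all $i,j$ there is $l\ge 1$ with $(M^l)_{ij}>0$; it may be periodic. The dominant positive eigenvalue $\lambda$ is the spectral radius of $M$, and $\psi$ has all coordinates strictly positive (unique up to scaling, by Perron-Frobenius). A matrix $S$ is stochastic on $M$ if $0\le S_{ij}\le 1$, $\sum_jS_{ij}=1$ for all $i$, and $M_{ij}=0\Rightarrow S_{ij}=0$. A length $l$ path or pathway on $M$ is a sequence $(\gamma_i)_{i=0}^l$ of vertices with $M_{\gamma_i\gamma_{i+1}}>0$ for all $0\le i<l$. Pathways $(\gamma_0,\dots,\gamma_l)$ and $(\gamma'_0,\dots,\gamma'_l)$ are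 equally probable (for $S$) if $$\frac{S_{\gamma_0\gamma_1}S_{\gamma_1\gamma_2}\cdots S_{\gamma_{l-1}\gamma_l}}{S_{\gamma'_0\gamma'_1}S_{\gamma'_1\gamma'_2}\cdots S_{\gamma'_{l-1}\gamma'_l}}=\frac{M_{\gamma_0\gamma_1}M_{\gamma_1\gamma_2}\cdots M_{\gamma_{l-1}\gamma_l}}{M_{\gamma'_0\gamma'_1}M_{\gamma'_1\gamma'_2}\cdots M_{\gamma'_{l-1}\gamma'_l}}$$ (in particular the denominators are nonzero). *)

theory Defs
  imports Complex_Main "Jordan_Normal_Form.Spectral_Radius"
begin

text \<open>The vertex set \<open>{1,\<dots>,N}\<close> is rendered as \<open>{0..<N}\<close>, following the 0-based
  indexing of \<^typ>\<open>real mat\<close>.\<close>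

definition nonneg_matrix :: "nat \<Rightarrow> real mat \<Rightarrow> bool" where
  "nonneg_matrix N M \<longleftrightarrow> M \<in> carrier_mat N N \<and> (\<forall>i<N. \<forall>j<N. 0 \<le> M $$ (i, j))"

definition strongly_connected_mat :: "nat \<Rightarrow> real mat \<Rightarrow> bool" where
  "strongly_connected_mat N M \<longleftrightarrow> (\<forall>i<N. \<forall>j<N. \<exists>l\<ge>1. (M ^\<^sub>m l) $$ (i, j) > 0)"

definition stochastic_on :: "nat \<Rightarrow> real mat \<Rightarrow> real mat \<Rightarrow> bool" where
  "stochastic_on N M S \<longleftrightarrow> S \<in> carrier_mat N N
     \<and> (\<forall>i<N. \<forall>j<N. 0 \<le> S $$ (i, j) \<and> S $$ (i, j) \<le> 1)
     \<and> (\<forall>i<N. (\<Sum>j<N. S $$ (i, j)) = 1)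
     \<and> (\<forall>i<N. \<forall>j<N. M $$ (i, j) = 0 \<longrightarrow> S $$ (i, j) = 0)"

text \<open>A length \<open>l\<close> pathway is a function on \<^typ>\<open>nat\<close> of which only the values at
  \<open>0,\<dots>,l\<close> matter.\<close>

definition pathway :: "nat \<Rightarrow> real mat \<Rightarrow> nat \<Rightarrow> (nat \<Rightarrow> nat) \<Rightarrow> bool" where
  "pathway N M l \<gamma> \<longleftrightarrow> (\<forall>i\<le>l. \<gamma> i < N) \<and> (\<forall>i<l. M $$ (\<gamma> i, \<gamma> (Suc i)) > 0)"

definition path_weight :: "real mat \<Rightarrow> nat \<Rightarrow> (nat \<Rightarrow> nat) \<Rightarrow> real" where
  "path_weight A l \<gamma> = (\<Prod>i<l. A $$ (\<gamma> i, \<gamma> (Suc i)))"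

text \<open>Division by zero is total in HOL, so the denominators are required to be nonzero
  explicitly.\<close>

definition equally_probable ::
  "real mat \<Rightarrow> real mat \<Rightarrow> nat \<Rightarrow> (nat \<Rightarrow> nat) \<Rightarrow> (nat \<Rightarrow> nat) \<Rightarrow> bool" where
  "equally_probable M S l \<gamma> \<gamma>' \<longleftrightarrow>
     path_weight S l \<gamma>' \<noteq> 0 \<and> path_weight M l \<gamma>' \<noteq> 0 \<and>
     path_weight S l \<gamma> / path_weight S l \<gamma>' = path_weight M l \<gamma> / path_weight M l \<gamma>'"

definition all_pathways_equally_probable :: "nat \<Rightarrow> real mat \<Rightarrow> real mat \<Rightarrow> bool" where
  "all_pathways_equally_probable N M S \<longleftrightarrow>
     (\<forall>l\<ge>1. \<forall>a<N. \<forall>b<N. \<forall>\<gamma> \<gamma>'.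
        pathway N M l \<gamma> \<and> pathway N M l \<gamma>' \<and>
        \<gamma> 0 = a \<and> \<gamma>' 0 = a \<and> \<gamma> l = b \<and> \<gamma>' l = b \<longrightarrow>
        equally_probable M S l \<gamma> \<gamma>')"

definition merw :: "nat \<Rightarrow> real mat \<Rightarrow> real \<Rightarrow> real vec \<Rightarrow> real mat" where
  "merw N M ev \<psi> = mat N N (\<lambda>(i, j). M $$ (i, j) / ev * (\<psi> $ j / \<psi> $ i))"

end

theory Submission
  imports Defs
begin

text \<open>If \<open>S\<close> makes pathways with common endpoints equally probable, then the total of
  \<open>ln (S\<^sub>i\<^sub>j / M\<^sub>i\<^sub>j)\<close> along a walk depends only on its endpoints and length. For a cycle \<open>C\<close>
  at \<open>a\<close>, a cycle \<open>D\<close> at \<open>b\<close> and a walk \<open>P\<close> from \<open>a\<close> to \<open>b\<close>, the walks \<open>C\<^sup>m P\<close> and \<open>P D\<^sup>k\<close>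
  with \<open>m = |D|\<close> and \<open>k = |C|\<close> have equal length, so the mean of the edge weight is the same
  for all cycles; this works without aperiodicity. After subtracting the mean the edge
  weight is a gradient, so \<open>S\<^sub>i\<^sub>j = c M\<^sub>i\<^sub>j F\<^sub>j / F\<^sub>i\<close>, which is
  \<open>\<kappa> P\<^sub>i\<^sub>j h\<^sub>j / h\<^sub>i\<close> for the maximal entropy walk \<open>P\<close>. The maximum principle for \<open>h\<close> gives
  \<open>\<kappa> = 1\<close> and \<open>h\<close> constant.\<close>

section \<open>Weighted walks, mean cycle weight and potentials\<close>

inductive walk :: "('a \<Rightarrow> 'a \<Rightarrow> bool) \<Rightarrow> ('a \<Rightarrow> 'a \<Rightarrow> real) \<Rightarrow> 'a \<Rightarrow> 'a \<Rightarrow> nat \<Rightarrow> real \<Rightarrow> bool"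
  for E g where
  walk_refl: "walk E g a a 0 0"
| walk_step: "walk E g a b l w \<Longrightarrow> E b d \<Longrightarrow> walk E g a d (Suc l) (w + g b d)"

lemma walk_edge: "E a b \<Longrightarrow> walk E g a b 1 (g a b)"
  using walk_step[OF walk_refl] by fastforce

text \<open>A \<open>walk\<close> grows at its end, so the induction runs over the later of the two
  walks, which therefore comes first among the assumptions.\<close>

lemma walk_append:
  assumes "walk E g b d m v" "walk E g a b l w"
  shows "walk E g a d (l + m) (w + v)"
  using assms
proof (induction rule: walk.induct)
  case (walk_step b c m v d)
  then show ?case
    using walk.walk_step[of E g a c "l + m" "w + v" d] by (simp add: add.assoc)
qed simp

lemma walk_repeat:
  assumes "walk E g a a l w"
  shows "walk E g a a (n * l) (real n * w)"
proof (induction n)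
  case 0
  show ?case by (simp add: walk_refl)
next
  case (Suc n)
  show ?case
    using walk_append[OF Suc assms] by (simp add: algebra_simps)
qed

lemma walk_closed_mean:
  assumes uniq: "\<And>a b l w w'. walk E g a b l w \<Longrightarrow> walk E g a b l w' \<Longrightarrow> w = w'"
    and C: "walk E g a a k u" and D: "walk E g b b m v" and P: "walk E g a b l w"
  shows "real m * u = real k * v"
proof -
  have "walk E g a b (l + k * m) (real m * u + w)"
    using walk_append[OF P walk_repeat[OF C, of m]] by (simp add: ac_simps)
  moreover have "walk E g a b (l + k * m) (w + real k * v)"
    using walk_append[OF walk_repeat[OF D, of k] P] by simp
  ultimately show ?thesis using uniq by fastforce
qed

text \<open>Subtracting the common cycle mean \<open>c\<close> from each edge gives every closed
  walk at a vertex of \<open>V\<close> weight 0. The corrected weight of walks from a fixed root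
  then serves as the potential \<open>f\<close>.\<close>

lemma walk_potential:
  assumes uniq: "\<And>a b l w w'. walk E g a b l w \<Longrightarrow> walk E g a b l w' \<Longrightarrow> w = w'"
    and conn: "\<And>a b. a \<in> V \<Longrightarrow> b \<in> V \<Longrightarrow> \<exists>l\<ge>1. \<exists>w. walk E g a b l w"
  obtains c f where "\<And>a b. a \<in> V \<Longrightarrow> b \<in> V \<Longrightarrow> E a b \<Longrightarrow> g a b = c + f b - f a"
proof (cases "V = {}")
  case True
  then show ?thesis using that by simp
next
  case False
  then obtain r where r: "r \<in> V" by blast
  obtain k u where k: "k \<ge> 1" and C: "walk E g r r k u"
    using conn[OF r r] by blast
  define c where "c = u / real k"
  have mean: "v = real m * c" if "a \<in> V" "walk E g a a m v" for a m v
  proof -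
    obtain l w where "walk E g r a l w" using conn[OF r \<open>a \<in> V\<close>] by blast
    from walk_closed_mean[OF uniq C that(2) this] have "real m * u = real k * v" .
    with k show ?thesis by (simp add: c_def field_simps)
  qed
  \<comment> \<open>Any walk from \<open>r\<close> to \<open>a\<close> may define
    \<open>f a\<close>; the comparison below works for every choice.\<close>
  have "\<forall>a\<in>V. \<exists>x. \<exists>l w. walk E g r a l w \<and> x = w - real l * c"
    using conn[OF r] by blast
  then obtain f where f: "\<And>a. a \<in> V \<Longrightarrow> \<exists>l w. walk E g r a l w \<and> f a = w - real l * c"
    using bchoice[of V "\<lambda>a x. \<exists>l w. walk E g r a l w \<and> x = w - real l * c"] by blast
  have "g a b = c + f b - f a" if "a \<in> V" "b \<in> V" "E a b" for a b
  proof -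
    obtain l w where P: "walk E g r a l w" and fa: "f a = w - real l * c"
      using f[OF \<open>a \<in> V\<close>] by blast
    obtain l' w' where P': "walk E g r b l' w'" and fb: "f b = w' - real l' * c"
      using f[OF \<open>b \<in> V\<close>] by blast
    obtain m v where Q: "walk E g b r m v"
      using conn[OF \<open>b \<in> V\<close> r] by blast
    \<comment> \<open>Both walks from \<open>r\<close> to \<open>b\<close>, one of them ending with
      the edge from \<open>a\<close>, are closed up by the same return walk \<open>Q\<close>. The
      difference of the two mean equations eliminates \<open>v\<close> and \<open>m\<close>.\<close>
    have "w + g a b + v = real (Suc l + m) * c"
      using mean[OF r walk_append[OF Q walk_step[OF P \<open>E a b\<close>]]] .
    moreover have "w' + v = real (l' + m) * c"
      using mean[OF r walk_append[OF Q P']] .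
    ultimately show ?thesis by (simp add: fa fb algebra_simps)
  qed
  then show ?thesis by (rule that)
qed

lemma walk_invariant:
  assumes "walk E g a b l w" "\<And>x y. E x y \<Longrightarrow> Q x \<Longrightarrow> Q y" "Q a"
  shows "Q b"
  using assms by (induction rule: walk.induct) auto

section \<open>Maximum principle for a conjugated stochastic matrix\<close>

lemma stochastic_conjugate_eq:
  fixes P :: "nat \<Rightarrow> nat \<Rightarrow> real" and h :: "nat \<Rightarrow> real"
  assumes P0: "\<And>i j. i < N \<Longrightarrow> j < N \<Longrightarrow> 0 \<le> P i j"
    and P1: "\<And>i. i < N \<Longrightarrow> (\<Sum>j<N. P i j) = 1"
    and S1: "\<And>i. i < N \<Longrightarrow> (\<Sum>j<N. P i j * \<kappa> * h j / h i) = 1"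
    and h: "\<And>i. i < N \<Longrightarrow> 0 < h i"
    and conn: "\<And>i j. i < N \<Longrightarrow> j < N \<Longrightarrow>
      \<exists>l w. walk (\<lambda>a b. a < N \<and> b < N \<and> 0 < P a b) g i j l w"
    and ij: "i < N" "j < N"
  shows "P i j * \<kappa> * h j / h i = P i j"
proof -
  let ?V = "h ` {..<N}"
  have ne: "finite ?V" "?V \<noteq> {}" using ij by auto
  have "Max ?V \<in> ?V" using ne by (rule Max_in)
  then obtain p where p: "p < N" "Max ?V = h p" by auto
  have "Min ?V \<in> ?V" using ne by (rule Min_in)
  then obtain q where q: "q < N" "Min ?V = h q" by auto
  have hp: "h i \<le> h p" and hq: "h q \<le> h i" if "i < N" for i
    using that Max_ge[of ?V "h i"] Min_le[of ?V "h i"] p q by auto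
  \<comment> \<open>The row sums of the conjugated matrix amount to the eigenvector equation
    \<open>\<kappa> P h = h\<close>.\<close>
  have eq: "\<kappa> * (\<Sum>j<N. P i j * h j) = h i" if "i < N" for i
  proof -
    have "(\<Sum>j<N. P i j * \<kappa> * h j / h i) = \<kappa> * (\<Sum>j<N. P i j * h j) / h i"
      by (simp add: sum_distrib_left sum_divide_distrib mult_ac)
    then show ?thesis using S1[OF that] h[OF that] by (simp add: field_simps)
  qed
  have avg: "(\<Sum>j<N. P i j * x) = x" if "i < N" for i x
    using P1[OF that] by (simp flip: sum_distrib_right)
  have "(\<Sum>j<N. P p j * h j) \<le> (\<Sum>j<N. P p j * h p)"
    by (intro sum_mono mult_left_mono) (use hp P0 p in auto)
  then have up: "(\<Sum>j<N. P p j * h j) \<le> h p" by (simp only: avg[OF p(1)])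
  have "(\<Sum>j<N. P q j * h q) \<le> (\<Sum>j<N. P q j * h j)"
    by (intro sum_mono mult_left_mono) (use hq P0 q in auto)
  then have low: "h q \<le> (\<Sum>j<N. P q j * h j)" by (simp only: avg[OF q(1)])
  \<comment> \<open>The sign of \<open>\<kappa>\<close> comes from the equation at \<open>q\<close>.
    It is needed to multiply the averaging bounds, which then give \<open>\<kappa> \<ge> 1\<close>
    at the maximum and \<open>\<kappa> \<le> 1\<close> at the minimum.\<close>
  have "0 < (\<Sum>j<N. P q j * h j)" using low h[OF q(1)] by linarith
  then have "\<kappa> > 0" using eq[OF q(1)] h[OF q(1)] by (metis zero_less_mult_pos2)
  have "h p \<le> \<kappa> * h p"
    using mult_left_mono[OF up, of \<kappa>] eq[OF p(1)] \<open>\<kappa> > 0\<close> by simp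
  moreover have "\<kappa> * h q \<le> h q"
    using mult_left_mono[OF low, of \<kappa>] eq[OF q(1)] \<open>\<kappa> > 0\<close> by simp
  ultimately have k: "\<kappa> = 1" using h[OF p(1)] h[OF q(1)] by simp
  have step: "h b = h p" if ab: "a < N \<and> b < N \<and> 0 < P a b" and ha: "h a = h p" for a b
  proof -
    \<comment> \<open>With \<open>\<kappa> = 1\<close> the function \<open>h\<close> is harmonic. At
      a maximiser the nonnegative terms sum to 0, so each vanishes and the maximum passes to every
      successor.\<close>
    have "(\<Sum>j<N. P a j * (h p - h j)) = 0"
      using eq[of a] avg[of a "h p"] ab k ha by (simp add: right_diff_distrib sum_subtractf)
    moreover have "0 \<le> P a j * (h p - h j)" if "j < N" for j
      using P0[of a j] hp[OF that] ab that by simp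
    ultimately have "P a b * (h p - h b) = 0"
      using ab by (subst (asm) sum_nonneg_eq_0_iff) blast+
    then show ?thesis using ab by simp
  qed
  have const: "h b = h p" if b: "b < N" for b
  proof -
    obtain l w where "walk (\<lambda>a b. a < N \<and> b < N \<and> 0 < P a b) g p b l w"
      using conn[OF p(1) b] by blast
    from walk_invariant[OF this, of "\<lambda>x. h x = h p"] step show ?thesis by blast
  qed
  show ?thesis using const[OF ij(1)] const[OF ij(2)] h[OF p(1)] k by simp
qed

section \<open>Walks on the graph of a matrix, pathways and matrix powers\<close>

definition edge :: "nat \<Rightarrow> real mat \<Rightarrow> nat \<Rightarrow> nat \<Rightarrow> bool" where
  "edge N M a b \<longleftrightarrow> a < N \<and> b < N \<and> 0 < M $$ (a, b)"

text \<open>Links inductive walks to the vertex sequences on which equal probability is stated. The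
  bound on \<open>a\<close> matters for length 0, since \<open>walk_refl\<close> admits every number
  as a vertex.\<close>

lemma walk_imp_pathway:
  assumes "walk (edge N M) g a b l w" "a < N"
  shows "\<exists>\<gamma>. pathway N M l \<gamma> \<and> \<gamma> 0 = a \<and> \<gamma> l = b \<and> w = (\<Sum>i<l. g (\<gamma> i) (\<gamma> (Suc i)))"
  using assms
proof (induction rule: walk.induct)
  case (walk_refl a)
  then show ?case by (intro exI[of _ "\<lambda>_. a"]) (auto simp: pathway_def)
next
  case (walk_step a b l w d)
  then obtain \<gamma> where \<gamma>: "pathway N M l \<gamma>" "\<gamma> 0 = a" "\<gamma> l = b"
    "w = (\<Sum>i<l. g (\<gamma> i) (\<gamma> (Suc i)))" by blast
  let ?\<gamma> = "\<gamma>(Suc l := d)"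
  have "pathway N M (Suc l) ?\<gamma>"
    using \<gamma> walk_step.hyps by (auto simp: pathway_def edge_def less_Suc_eq le_Suc_eq)
  moreover have "w + g b d = (\<Sum>i<Suc l. g (?\<gamma> i) (?\<gamma> (Suc i)))"
    using \<gamma> by simp
  ultimately show ?case using \<gamma>(2) by (intro exI[of _ ?\<gamma>]) (simp del: fun_upd_apply, simp)
qed

text \<open>A nonzero entry of a power has a nonzero summand, which supplies the last edge. Tracking
  nonzero instead of positive entries avoids a separate proof that powers are nonnegative.\<close>

lemma pow_mat_nonzero_imp_walk:
  assumes M: "nonneg_matrix N M" and "i < N" "j < N" "(M ^\<^sub>m l) $$ (i, j) \<noteq> 0"
  shows "\<exists>w. walk (edge N M) g i j l w"
  using assms(3,4)
proof (induction l arbitrary: j)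
  case 0
  then have "i = j" using \<open>i < N\<close> M by (auto simp: nonneg_matrix_def split: if_splits)
  then show ?case using walk_refl[of "edge N M" g j] by auto
next
  case (Suc l)
  have c: "M \<in> carrier_mat N N" "M ^\<^sub>m l \<in> carrier_mat N N"
    using M by (auto simp: nonneg_matrix_def)
  have "(M ^\<^sub>m Suc l) $$ (i, j) = (\<Sum>k<N. (M ^\<^sub>m l) $$ (i, k) * M $$ (k, j))"
    using c Suc.prems \<open>i < N\<close> by (simp add: scalar_prod_def atLeast0LessThan)
  with Suc.prems obtain k where k: "k < N" "(M ^\<^sub>m l) $$ (i, k) \<noteq> 0" "M $$ (k, j) \<noteq> 0"
    by (metis (no_types, lifting) lessThan_iff mult_eq_0_iff sum.neutral)
  then have "edge N M k j"
    using M Suc.prems by (auto simp: edge_def nonneg_matrix_def order_less_le)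
  with Suc.IH[OF k(1,2)] show ?case by (blast intro: walk_step)
qed

section \<open>Path weights and the maximal entropy walk\<close>

lemma path_weight_pos:
  assumes "pathway N M l \<gamma>" "\<And>a b. edge N M a b \<Longrightarrow> 0 < A $$ (a, b)"
  shows "0 < path_weight A l \<gamma>"
  unfolding path_weight_def
  by (intro prod_pos ballI assms(2)) (use assms(1) in \<open>auto simp: pathway_def edge_def\<close>)

lemma ln_path_weight:
  assumes "pathway N M l \<gamma>" "\<And>a b. edge N M a b \<Longrightarrow> 0 < A $$ (a, b)"
  shows "ln (path_weight A l \<gamma>) = (\<Sum>i<l. ln (A $$ (\<gamma> i, \<gamma> (Suc i))))"
  unfolding path_weight_def
  by (intro ln_prod less_imp_neq[symmetric] assms(2))
    (use assms(1) in \<open>auto simp: pathway_def edge_def\<close>)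

text \<open>The factors \<open>\<psi>\<close> telescope along the pathway, and each edge contributes
  one factor \<open>1 / ev\<close>.\<close>

lemma path_weight_merw:
  assumes "pathway N M l \<gamma>" "\<forall>i<N. \<psi> $ i > 0"
  shows "path_weight (merw N M ev \<psi>) l \<gamma> =
    path_weight M l \<gamma> / ev ^ l * (\<psi> $ \<gamma> l / \<psi> $ \<gamma> 0)"
  using assms(1)
proof (induction l)
  case 0
  then have "\<psi> $ \<gamma> 0 > 0" using assms(2) by (auto simp: pathway_def)
  then show ?case by (simp add: path_weight_def)
next
  case (Suc l)
  have IH: "path_weight (merw N M ev \<psi>) l \<gamma> =
    path_weight M l \<gamma> / ev ^ l * (\<psi> $ \<gamma> l / \<psi> $ \<gamma> 0)"
    using Suc by (auto simp: pathway_def)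
  have lt: "\<gamma> l < N" "\<gamma> (Suc l) < N" using Suc.prems by (auto simp: pathway_def)
  then have "\<psi> $ \<gamma> l \<noteq> 0" using assms(2) by auto
  moreover have "path_weight A (Suc l) \<gamma> = path_weight A l \<gamma> * A $$ (\<gamma> l, \<gamma> (Suc l))" for A
    by (simp add: path_weight_def)
  ultimately show ?case using IH lt by (simp add: merw_def mult_ac)
qed

text \<open>The factor by which the weights for the walk and for \<open>M\<close> differ depends
  only on length and endpoints, so it cancels in the quotient.\<close>

lemma merw_equally_probable:
  assumes "ev > 0" "\<forall>i<N. \<psi> $ i > 0"
  shows "all_pathways_equally_probable N M (merw N M ev \<psi>)"
  unfolding all_pathways_equally_probable_def
proof (intro allI impI, elim conjE)
  fix l a b \<gamma> \<gamma>'
  assume a: "a < N" "b < N" and \<gamma>: "pathway N M l \<gamma>" "pathway N M l \<gamma>'"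
    and ends: "\<gamma> 0 = a" "\<gamma>' 0 = a" "\<gamma> l = b" "\<gamma>' l = b"
  have "0 < path_weight M l \<gamma>'" using \<gamma>(2) by (rule path_weight_pos) (simp add: edge_def)
  moreover have "\<psi> $ a > 0" "\<psi> $ b > 0" using a assms(2) by auto
  ultimately show "equally_probable M (merw N M ev \<psi>) l \<gamma> \<gamma>'"
    using assms(1) path_weight_merw[OF \<gamma>(1) assms(2)] path_weight_merw[OF \<gamma>(2) assms(2)]
    by (simp add: equally_probable_def ends)
qed

lemma merw_stochastic:
  assumes M: "nonneg_matrix N M" and "ev > 0" "eigenvector M \<psi> ev"
    and \<psi>: "\<forall>i<N. \<psi> $ i > 0"
  shows "stochastic_on N M (merw N M ev \<psi>)"
proof -
  let ?P = "merw N M ev \<psi>"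
  have c: "M \<in> carrier_mat N N" "\<psi> \<in> carrier_vec N" "M *\<^sub>v \<psi> = ev \<cdot>\<^sub>v \<psi>"
    using M assms(3) by (auto simp: nonneg_matrix_def eigenvector_def)
  have nn: "0 \<le> ?P $$ (i, j)" if "i < N" "j < N" for i j
    using that M \<psi> \<open>ev > 0\<close> by (auto simp: merw_def nonneg_matrix_def less_imp_le)
  have sum: "(\<Sum>j<N. ?P $$ (i, j)) = 1" if "i < N" for i
  proof -
    \<comment> \<open>Row \<open>i\<close> of the eigenvector equation is exactly the normalisation
      of row \<open>i\<close> of \<open>?P\<close>.\<close>
    have "(M *\<^sub>v \<psi>) $ i = (\<Sum>j<N. M $$ (i, j) * \<psi> $ j)"
      using c(1,2) that by (simp add: scalar_prod_def atLeast0LessThan)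
    then have "(\<Sum>j<N. M $$ (i, j) * \<psi> $ j) = ev * \<psi> $ i"
      using c that by simp
    moreover have "(\<Sum>j<N. ?P $$ (i, j)) = (\<Sum>j<N. M $$ (i, j) * \<psi> $ j) / (ev * \<psi> $ i)"
      using that by (simp add: merw_def flip: sum_divide_distrib)
    moreover have "\<psi> $ i > 0" using \<psi> that by blast
    ultimately show ?thesis using \<open>ev > 0\<close> by simp
  qed
  have "?P $$ (i, j) \<le> 1" if "i < N" "j < N" for i j
    using member_le_sum[of j "{..<N}" "\<lambda>j. ?P $$ (i, j)"] nn sum that by auto
  moreover have "?P \<in> carrier_mat N N" by (simp add: merw_def)
  ultimately show ?thesis
    using nn sum by (auto simp: stochastic_on_def merw_def)
qed

section \<open>Uniqueness from equal probability\<close>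

lemma equally_probable_edge_pos:
  assumes "stochastic_on N M S" "all_pathways_equally_probable N M S" "edge N M a b"
  shows "0 < S $$ (a, b)"
proof -
  define \<gamma> where "\<gamma> = (\<lambda>i::nat. if i = 0 then a else b)"
  have "pathway N M 1 \<gamma>" using assms(3) by (auto simp: pathway_def edge_def \<gamma>_def)
  \<comment> \<open>The pathway is compared with itself: the quotients agree trivially, and the
    content is the nonzero denominator.\<close>
  then have "equally_probable M S 1 \<gamma> \<gamma>"
    using assms(2,3) unfolding all_pathways_equally_probable_def edge_def
    by (auto simp: \<gamma>_def)
  then have "S $$ (a, b) \<noteq> 0" by (simp add: equally_probable_def path_weight_def \<gamma>_def)
  moreover have "0 \<le> S $$ (a, b)" using assms(1,3) by (auto simp: stochastic_on_def edge_def)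
  ultimately show ?thesis by simp
qed

text \<open>The sum of \<open>g\<close> along a pathway is the logarithm of its
  \<open>S\<close>-weight over its \<open>M\<close>-weight, a ratio that equal probability fixes
  once length and endpoints are given.\<close>

lemma equally_probable_walk_weight_unique:
  assumes pos: "\<And>a b. edge N M a b \<Longrightarrow> 0 < S $$ (a, b)"
    and S: "all_pathways_equally_probable N M S"
    and g: "g = (\<lambda>a b. ln (S $$ (a, b)) - ln (M $$ (a, b)))"
    and w: "walk (edge N M) g a b l w" "walk (edge N M) g a b l w'"
  shows "w = w'"
\<comment> \<open>Equal probability speaks only of \<open>l \<ge> 1\<close>; at length 0 both
  weights are 0.\<close>
proof (cases "l = 0")
  case True
  then show ?thesis using w by (auto elim: walk.cases)
next
  case False
  have "a < N"
  proof -
    \<comment> \<open>Only a first edge forces the start into range, hence the exception for length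
      0.\<close>
    have "n = 0 \<or> x < N" if "walk (edge N M) g x y n v" for x y n v
      using that
    proof (induction rule: walk.induct)
      case (walk_step a b l w d)
      then show ?case by (cases l) (auto simp: edge_def elim: walk.cases)
    qed simp
    then show ?thesis using w(1) False by blast
  qed
  obtain \<gamma> where \<gamma>: "pathway N M l \<gamma>" "\<gamma> 0 = a" "\<gamma> l = b"
      "w = (\<Sum>i<l. g (\<gamma> i) (\<gamma> (Suc i)))"
    using walk_imp_pathway[OF w(1) \<open>a < N\<close>] by blast
  obtain \<gamma>' where \<gamma>': "pathway N M l \<gamma>'" "\<gamma>' 0 = a" "\<gamma>' l = b"
      "w' = (\<Sum>i<l. g (\<gamma>' i) (\<gamma>' (Suc i)))"
    using walk_imp_pathway[OF w(2) \<open>a < N\<close>] by blast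
  have Mpos: "\<And>a b. edge N M a b \<Longrightarrow> 0 < M $$ (a, b)" by (simp add: edge_def)
  note pw = path_weight_pos[OF \<gamma>(1) pos] path_weight_pos[OF \<gamma>'(1) pos]
    path_weight_pos[OF \<gamma>(1) Mpos] path_weight_pos[OF \<gamma>'(1) Mpos]
  have wM: "w = ln (path_weight S l \<gamma>) - ln (path_weight M l \<gamma>)"
    "w' = ln (path_weight S l \<gamma>') - ln (path_weight M l \<gamma>')"
    using ln_path_weight[OF \<gamma>(1) pos] ln_path_weight[OF \<gamma>(1) Mpos]
      ln_path_weight[OF \<gamma>'(1) pos] ln_path_weight[OF \<gamma>'(1) Mpos]
    by (simp_all add: \<gamma>(4) \<gamma>'(4) g sum_subtractf)
  have "b < N" using \<gamma>(1,3) by (auto simp: pathway_def)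
  then have "equally_probable M S l \<gamma> \<gamma>'"
    using S \<gamma> \<gamma>' \<open>a < N\<close> False unfolding all_pathways_equally_probable_def by auto
  then have "ln (path_weight S l \<gamma> / path_weight S l \<gamma>') =
      ln (path_weight M l \<gamma> / path_weight M l \<gamma>')"
    by (simp add: equally_probable_def)
  then show ?thesis using pw wM by (simp add: ln_div)
qed

lemma equally_probable_unique:
  assumes M: "nonneg_matrix N M" and sc: "strongly_connected_mat N M"
    and "ev > 0" "eigenvector M \<psi> ev" and \<psi>: "\<forall>i<N. \<psi> $ i > 0"
    and S: "stochastic_on N M S" "all_pathways_equally_probable N M S"
  shows "S = merw N M ev \<psi>"
proof -
  let ?P = "merw N M ev \<psi>"
  define g where "g = (\<lambda>a b. ln (S $$ (a, b)) - ln (M $$ (a, b)))"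
  note Spos = equally_probable_edge_pos[OF S]
  have conn: "\<exists>l\<ge>1. \<exists>w. walk (edge N M) g i j l w" if "i \<in> {..<N}" "j \<in> {..<N}" for i j
    using that sc pow_mat_nonzero_imp_walk[OF M, of i j _ g]
    unfolding strongly_connected_mat_def by (metis lessThan_iff less_irrefl)
  obtain c f where cf: "\<And>a b. a \<in> {..<N} \<Longrightarrow> b \<in> {..<N} \<Longrightarrow> edge N M a b \<Longrightarrow>
      g a b = c + f b - f a"
    using walk_potential[where E = "edge N M" and g = g and V = "{..<N}"]
      equally_probable_walk_weight_unique[OF Spos S(2) g_def] conn by metis
  \<comment> \<open>\<open>h\<close> and \<open>\<kappa>\<close> absorb the factors
    \<open>\<psi>\<close> and \<open>1 / ev\<close> of \<open>?P\<close>, so that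
    \<open>M $$ (i, j) * exp (c + f j - f i)\<close> becomes
    \<open>?P $$ (i, j) * \<kappa> * h j / h i\<close>.\<close>
  define h where "h = (\<lambda>i. exp (f i) / \<psi> $ i)"
  define \<kappa> where "\<kappa> = exp c * ev"
  have P: "stochastic_on N M ?P" using merw_stochastic[OF M \<open>ev > 0\<close> assms(4) \<psi>] .
  have hpos: "0 < h i" if "i < N" for i using \<psi> that by (simp add: h_def)
  have SP: "S $$ (i, j) = ?P $$ (i, j) * \<kappa> * h j / h i" if ij: "i < N" "j < N" for i j
  proof (cases "M $$ (i, j) = 0")
    case True
    then show ?thesis using S(1) ij by (simp add: stochastic_on_def merw_def)
  next
    case False
    then have e: "edge N M i j"
      using M ij by (auto simp: edge_def nonneg_matrix_def order_less_le)
    then have Mp: "0 < M $$ (i, j)" by (simp add: edge_def)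
    have "ln (S $$ (i, j)) = ln (M $$ (i, j)) + (c + f j - f i)"
      using cf[OF _ _ e] ij by (simp add: g_def)
    then have "exp (ln (S $$ (i, j))) = exp (ln (M $$ (i, j))) * (exp c * exp (f j) / exp (f i))"
      by (simp add: exp_add exp_diff)
    then have "S $$ (i, j) = M $$ (i, j) * (exp c * exp (f j) / exp (f i))"
      using Spos[OF e] Mp by simp
    moreover have "\<psi> $ i > 0" "\<psi> $ j > 0" using \<psi> ij by auto
    ultimately show ?thesis using ij \<open>ev > 0\<close> by (simp add: merw_def h_def \<kappa>_def field_simps)
  qed
  \<comment> \<open>\<open>?P\<close> rescales the entries of \<open>M\<close> by positive factors,
    so the connectivity of \<open>M\<close> carries over to \<open>?P\<close>.\<close>
  have edgeP: "edge N M = (\<lambda>a b. a < N \<and> b < N \<and> 0 < ?P $$ (a, b))"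
  proof (intro ext)
    fix a b
    have "0 < ?P $$ (a, b) \<longleftrightarrow> 0 < M $$ (a, b)" if ab: "a < N" "b < N"
    proof -
      have "0 < \<psi> $ b / \<psi> $ a / ev" using \<psi> ab \<open>ev > 0\<close> by simp
      moreover have "?P $$ (a, b) = M $$ (a, b) * (\<psi> $ b / \<psi> $ a / ev)"
        using ab by (simp add: merw_def)
      ultimately show ?thesis by (simp only: zero_less_mult_iff) auto
    qed
    then show "edge N M a b = (a < N \<and> b < N \<and> 0 < ?P $$ (a, b))"
      by (auto simp: edge_def)
  qed
  have "S $$ (i, j) = ?P $$ (i, j)" if ij: "i < N" "j < N" for i j
  proof -
    have "?P $$ (i, j) * \<kappa> * h j / h i = ?P $$ (i, j)"
    proof (rule stochastic_conjugate_eq[where P = "\<lambda>i j. ?P $$ (i, j)" and N = N and g = g])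
      \<comment> \<open>By \<open>SP\<close> these are the row sums of \<open>S\<close>.\<close>
      show "(\<Sum>j<N. ?P $$ (i, j) * \<kappa> * h j / h i) = 1" if "i < N" for i
        using S(1) SP that by (simp add: stochastic_on_def)
      show "\<exists>l w. walk (\<lambda>a b. a < N \<and> b < N \<and> 0 < ?P $$ (a, b)) g i j l w"
        if "i < N" "j < N" for i j
        using conn[of i j] that unfolding edgeP by blast
    qed (use P hpos ij in \<open>auto simp: stochastic_on_def\<close>)
    then show ?thesis using SP[OF ij] by simp
  qed
  then show ?thesis
    using S(1) P by (intro eq_matI) (auto simp: stochastic_on_def)
qed

theorem mainTheorem3:
  fixes N :: nat and M :: "real mat" and ev :: real and \<psi> :: "real vec"
  assumes "nonneg_matrix N M"
    and "strongly_connected_mat N M"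
    and "ev > 0"
    and "ev = spectral_radius (map_mat complex_of_real M)"
    and "eigenvector M \<psi> ev"
    and "\<forall>i<N. \<psi> $ i > 0"
  shows "stochastic_on N M (merw N M ev \<psi>)
    \<and> all_pathways_equally_probable N M (merw N M ev \<psi>)
    \<and> (\<forall>S. stochastic_on N M S \<and> all_pathways_equally_probable N M S
          \<longrightarrow> S = merw N M ev \<psi>)"
  using merw_stochastic merw_equally_probable equally_probable_unique assms by blast

end
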